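(* Let $G$ be a commutative preordered group, $S$ an equivariant system of ideals for $G$, and $R$ the regularisation of $S$ (the least regular equivariant system of ideals containing $S$). Then for every nonempty finite subset $A$ of $G$, $R(A)$ holds iff there exists a nonempty finite subset $B$ of $G$ with $A+B\leqslant_S B$.
   Context: $G$ is an abelian group with a preorder $\leqslant$ such that $a\leqslant b$ implies $a+c\leqslant b+c$. For nonempty finite subsets write $A,B$ for $A\cup B$, $a$ for $\{a\}$, $A\pm x=\{a\pm x:a\in A\}$, $A+B=\{a+b:a\in A,b\in B\}$. An equivariant system of ideals is a predicate $S$ on nonempty finite subsets of $G$ such that: (P1) $S(A)$ if $A\supseteq A'$ and $S(A')$; (P2') $S(A)$ if $S(A,u)$ and $S(A-u)$; (P3) $S(a)$ if $a\leqslant 0$. It is regular if moreover (P2) $S(A+B)$ whenever $S(A+B,A)$ and $S(A+B,B)$, and (P5) $S(x,-x)$ for all $x$. $S'$ contains $S$ if $S(A)$ implies $S'(A)$. For nonempty finite $A,B$, $A\leqslant_S B$ means $S(A-b)$ for every $b\in B$. *)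

theory Defs
  imports "HOL-Library.Set_Algebras"
begin

class preordered_ab_group_add = ab_group_add + preorder +
  assumes add_right_monotone: "a \<le> b \<Longrightarrow> a + c \<le> b + c"

text \<open>
  A predicate on nonempty finite subsets of the group is represented by a predicate on all
  subsets; its values on empty or infinite sets are irrelevant, and every clause below is
  guarded accordingly.  The comma notation $A, B$ is union, so $S(A, u)$ becomes
  \<open>S (insert u A)\<close>; \<open>A + B\<close> is the elementwise sum from \<open>Set_Algebras\<close>.  Since \<open>-\<close> on sets is
  set difference, translates $A - x$ get their own notation.
\<close>

abbreviation fin_ne :: "'a set \<Rightarrow> bool"
  where "fin_ne A \<equiv> finite A \<and> A \<noteq> {}"

definition translate_down :: "'a::ab_group_add set \<Rightarrow> 'a \<Rightarrow> 'a set"  (infixl "\<ominus>" 65)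
  where "A \<ominus> x = (\<lambda>a. a - x) ` A"

locale equivariant_system_of_ideals =
  fixes S :: "'a::preordered_ab_group_add set \<Rightarrow> bool"
  assumes P1: "\<lbrakk>fin_ne A; fin_ne A'; A' \<subseteq> A; S A'\<rbrakk> \<Longrightarrow> S A"
    and P2': "\<lbrakk>fin_ne A; S (insert u A); S (A \<ominus> u)\<rbrakk> \<Longrightarrow> S A"
    and P3: "a \<le> 0 \<Longrightarrow> S {a}"

locale regular_equivariant_system_of_ideals = equivariant_system_of_ideals +
  assumes P2: "\<lbrakk>fin_ne A; fin_ne B; S ((A + B) \<union> A); S ((A + B) \<union> B)\<rbrakk> \<Longrightarrow> S (A + B)"
    and P5: "S {x, - x}"

definition system_contains :: "('a set \<Rightarrow> bool) \<Rightarrow> ('a set \<Rightarrow> bool) \<Rightarrow> bool"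
  where "system_contains S' S \<longleftrightarrow> (\<forall>A. fin_ne A \<longrightarrow> S A \<longrightarrow> S' A)"

definition is_regularisation ::
    "('a::preordered_ab_group_add set \<Rightarrow> bool) \<Rightarrow> ('a set \<Rightarrow> bool) \<Rightarrow> bool"
  where "is_regularisation S R \<longleftrightarrow>
    regular_equivariant_system_of_ideals R \<and> system_contains R S \<and>
    (\<forall>R'. regular_equivariant_system_of_ideals R' \<and> system_contains R' S
      \<longrightarrow> system_contains R' R)"

definition system_le ::
    "('a::ab_group_add set \<Rightarrow> bool) \<Rightarrow> 'a set \<Rightarrow> 'a set \<Rightarrow> bool"
  where "system_le S A B \<longleftrightarrow> (\<forall>b\<in>B. S (A \<ominus> b))"

lemma is_regularisation_exists:
  fixes S :: "'a::preordered_ab_group_add set \<Rightarrow> bool"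
  shows "\<exists>R. is_regularisation S R"
proof -
  define F where "F = {R'. regular_equivariant_system_of_ideals R' \<and> system_contains R' S}"
  define R where "R A \<longleftrightarrow> (\<forall>R'\<in>F. R' A)" for A
  have R_I: "R A" if "\<And>R'. R' \<in> F \<Longrightarrow> R' A" for A
    unfolding R_def by (rule ballI) (rule that)
  have R_D: "R' A" if "R A" "R' \<in> F" for A R'
    using that(1) unfolding R_def by (rule bspec) (rule that(2))
  have reg: "regular_equivariant_system_of_ideals R'" if "R' \<in> F" for R'
    using that by (simp add: F_def)
  note P = equivariant_system_of_ideals.P1 equivariant_system_of_ideals.P2'
    equivariant_system_of_ideals.P3
  note eq = regular_equivariant_system_of_ideals.axioms(1)[OF reg]
  have "regular_equivariant_system_of_ideals R"
  proof (unfold_locales, goal_cases)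
    case (1 A A')
    show ?case
      by (rule R_I, rule P(1)[OF eq 1(1-3) R_D[OF 1(4)]])
  next
    case (2 A u)
    show ?case
      by (rule R_I, rule P(2)[OF eq 2(1) R_D[OF 2(2)] R_D[OF 2(3)]])
  next
    case (3 a)
    show ?case
      by (rule R_I, rule P(3)[OF eq 3])
  next
    case (4 A B)
    show ?case
      by (rule R_I, rule regular_equivariant_system_of_ideals.P2
          [OF reg 4(1,2) R_D[OF 4(3)] R_D[OF 4(4)]])
  next
    case (5 x)
    show ?case
      by (rule R_I, rule regular_equivariant_system_of_ideals.P5[OF reg])
  qed
  moreover have "system_contains R S"
    by (simp add: system_contains_def R_def F_def)
  moreover have "system_contains R' R"
    if "regular_equivariant_system_of_ideals R' \<and> system_contains R' S" for R'
    unfolding system_contains_def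
  proof (intro allI impI)
    fix A assume "R A"
    moreover have "R' \<in> F" using that by (simp add: F_def)
    ultimately show "R' A" by (rule R_D)
  qed
  ultimately have "is_regularisation S R"
    unfolding is_regularisation_def by simp
  then show ?thesis by (rule exI[where x = R])
qed

lemma is_regularisation_unique:
  assumes "is_regularisation S R" "is_regularisation S R'" "fin_ne A"
  shows "R A \<longleftrightarrow> R' A"
  using assms by (auto simp only: is_regularisation_def system_contains_def)

end

theory Submission
  imports Defs
begin

text \<open>
  Read \<open>S A\<close> as ``the meet of \<open>A\<close> is at most \<open>0\<close>''. Finite nonempty sets, preordered by
  \<open>system_le S\<close> with sum as addition and union as meet, form a meet-semilattice ordered monoid,
  and the right-hand side of the theorem says that \<open>A \<le> 0\<close> holds in its Grothendieck group. As
  this is a lattice-ordered group, the right-hand side defines a regular system.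

  Conversely, for a regular \<open>R\<close> the relation \<open>R (A - B)\<close> is an entailment relation with
  cut, where \<open>A - B\<close> is the set of all differences. From \<open>A + B \<le> B\<close> one has
  \<open>R (A + B - b)\<close> for every \<open>b\<close> in \<open>B\<close>. Whatever function \<open>f\<close> from \<open>B\<close> to \<open>B\<close> is chosen,
  the set of all \<open>b - f b\<close> satisfies \<open>R\<close>, because \<open>f\<close> has a cycle, along which
  these differences sum to \<open>0\<close>. Hence \<open>A\<close> entails the disjunction over \<open>b\<close> of the
  conjunctions of \<open>A + B - b\<close>, and cuts give \<open>R A\<close>.
\<close>

section \<open>Sums and translates of finite sets\<close>

lemma fin_ne_plus:
  fixes A B :: "'a::plus set"
  shows "fin_ne A \<Longrightarrow> fin_ne B \<Longrightarrow> fin_ne (A + B)"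
  by (auto simp: set_plus_def finite_set_plus[unfolded set_plus_def])

lemma translate_down_translate_down:
  fixes A :: "'a::ab_group_add set"
  shows "A \<ominus> x \<ominus> y = A \<ominus> (x + y)"
  by (simp add: translate_down_def image_image algebra_simps)

lemma translate_down_0 [simp]:
  fixes A :: "'a::ab_group_add set"
  shows "A \<ominus> 0 = A"
  by (simp add: translate_down_def)

lemma fin_ne_translate_down:
  fixes A :: "'a::ab_group_add set"
  shows "fin_ne A \<Longrightarrow> fin_ne (A \<ominus> x)"
  by (simp add: translate_down_def)

lemma system_le_Un:
  "system_le S A (B \<union> C) \<longleftrightarrow> system_le S A B \<and> system_le S A C"
  by (auto simp: system_le_def)

section \<open>The preorder on finite sets given by an equivariant system\<close>

context equivariant_system_of_ideals
begin

lemma contains_0: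
  assumes "finite A" "0 \<in> A"
  shows "S A"
  using P1[of A "{0}"] P3[of 0] assms by auto

lemma system_le_superset:
  assumes "finite A" "B \<subseteq> A"
  shows "system_le S A B"
  unfolding system_le_def
proof
  fix b assume "b \<in> B"
  then have "0 \<in> A \<ominus> b"
    using assms(2) unfolding translate_down_def by force
  then show "S (A \<ominus> b)"
    using assms(1) by (intro contains_0) (auto simp: translate_down_def)
qed

text \<open>\<open>P2'\<close> discards the elements \<open>b\<close> of \<open>B\<close> one at a
  time: for the shift \<open>b - c\<close>, translating \<open>A \<ominus> c\<close> once more gives
  \<open>A \<ominus> b\<close>.\<close>

lemma Un_cut:
  assumes "finite B" "fin_ne A" "system_le S A B" "S ((A \<union> B) \<ominus> c)"
  shows "S (A \<ominus> c)"
  using assms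
proof (induction B arbitrary: A rule: finite_induct)
  case empty
  then show ?case by simp
next
  case (insert b B)
  let ?A = "insert b A"
  have Ab: "S (A \<ominus> b)"
    using insert.prems(2) by (simp add: system_le_def)
  have "system_le S ?A B"
    unfolding system_le_def
  proof
    fix x assume "x \<in> B"
    then have "S (A \<ominus> x)"
      using insert.prems(2) by (simp add: system_le_def)
    then show "S (?A \<ominus> x)"
      using insert.prems(1) by - (rule P1[of "?A \<ominus> x" "A \<ominus> x"], auto simp: translate_down_def)
  qed
  then have "S (?A \<ominus> c)"
    using insert.IH[of ?A] insert.prems by simp
  moreover have "?A \<ominus> c = insert (b - c) (A \<ominus> c)"
    by (simp add: translate_down_def)
  moreover have "A \<ominus> c \<ominus> (b - c) = A \<ominus> b"
    by (simp add: translate_down_translate_down)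
  ultimately show ?case
    using P2'[of "A \<ominus> c" "b - c"] Ab insert.prems(1) fin_ne_translate_down by metis
qed

lemma system_le_trans:
  assumes "fin_ne A" "fin_ne B" "system_le S A B" "system_le S B C"
  shows "system_le S A C"
  unfolding system_le_def
proof
  fix c assume "c \<in> C"
  then have "S (B \<ominus> c)"
    using assms(4) by (simp add: system_le_def)
  then have "S ((A \<union> B) \<ominus> c)"
    using assms(1,2) by - (rule P1[of "(A \<union> B) \<ominus> c" "B \<ominus> c"], auto simp: translate_down_def)
  then show "S (A \<ominus> c)"
    using Un_cut assms by blast
qed

lemma system_le_antimono:
  assumes "finite A" "fin_ne A'" "A' \<subseteq> A" "system_le S A' B"
  shows "system_le S A B"
  using system_le_trans[of A A' B] system_le_superset[of A A'] assms by blast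

lemma system_le_plus_right:
  assumes "fin_ne A" "fin_ne C" "system_le S A B"
  shows "system_le S (A + C) (B + C)"
  unfolding system_le_def
proof
  fix y assume "y \<in> B + C"
  then obtain b c where y: "y = b + c" "b \<in> B" "c \<in> C"
    by (auto simp: set_plus_def)
  have "A \<ominus> b \<subseteq> (A + C) \<ominus> y"
  proof
    fix z assume "z \<in> A \<ominus> b"
    then obtain a where "a \<in> A" "z = (a + c) - y"
      using y(1) by (auto simp: translate_down_def)
    then show "z \<in> (A + C) \<ominus> y"
      using y(3) by (auto simp: translate_down_def)
  qed
  moreover have "S (A \<ominus> b)"
    using assms(3) y(2) by (simp add: system_le_def)
  ultimately show "S ((A + C) \<ominus> y)"
    using P1 assms(1,2) fin_ne_translate_down fin_ne_plus by metis
qed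

lemma system_le_plus_left:
  assumes "fin_ne A" "fin_ne C" "system_le S A B"
  shows "system_le S (C + A) (C + B)"
  using system_le_plus_right[OF assms] by (simp add: add.commute)

section \<open>Regularity of the right-hand side\<close>

lemma regular_exists_plus_le:
  "regular_equivariant_system_of_ideals (\<lambda>A. \<exists>B. fin_ne B \<and> system_le S (A + B) B)"
proof (unfold_locales, goal_cases)
  case (1 A A')
  then obtain B where B: "fin_ne B" "system_le S (A' + B) B"
    by blast
  have "system_le S (A + B) B"
    using 1 B fin_ne_plus
    by - (rule system_le_antimono[of "A + B" "A' + B"], auto simp: set_plus_mono2)
  with B(1) show ?case by blast
next
  case (2 A u)
  from 2(2,3) obtain B C
    where B: "fin_ne B" "system_le S (insert u A + B) B"
      and C: "fin_ne C" "system_le S ((A \<ominus> u) + C) C"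
    by blast
  have fin: "fin_ne (A + (B + C))" "fin_ne (insert u A + B + C)"
    using 2(1) B(1) C(1) by (auto intro!: fin_ne_plus)
  \<comment> \<open>The witness is \<open>B + C\<close>. The hypothesis on
    \<open>A \<ominus> u\<close>, shifted by \<open>{u} + B\<close>, puts \<open>A + (B + C)\<close>
    below \<open>u + (B + C)\<close>; it is then below \<open>insert u A + B + C\<close>, hence
    below \<open>B + C\<close>.\<close>
  have "system_le S ({u} + B + ((A \<ominus> u) + C)) ({u} + B + C)"
    using 2(1) B(1) C
    by (intro system_le_plus_left fin_ne_plus fin_ne_translate_down) auto
  moreover have "{u} + (A \<ominus> u) = A"
    by (auto simp: set_plus_def translate_down_def)
  then have "{u} + B + ((A \<ominus> u) + C) = A + (B + C)"
    by (metis add.assoc add.commute)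
  ultimately have "system_le S (A + (B + C)) (A + (B + C) \<union> ({u} + (B + C)))"
    using fin by (simp add: system_le_Un system_le_superset add.assoc)
  moreover have "insert u A + B + C = A + (B + C) \<union> ({u} + (B + C))"
    by (metis Un_commute insert_is_Un Un_set_plus add.assoc)
  ultimately have "system_le S (A + (B + C)) (insert u A + B + C)"
    by simp
  then have "system_le S (A + (B + C)) (B + C)"
    using system_le_plus_right[OF _ C(1) B(2)] 2(1) B(1) fin fin_ne_plus
      system_le_trans[of "A + (B + C)" "insert u A + B + C" "B + C"]
    by (metis finite_insert insert_not_empty)
  with B(1) C(1) show ?case
    using fin_ne_plus by blast
next
  case (3 a)
  then have "system_le S ({a} + {0}) {0}"
    using P3 by (simp add: system_le_def)
  then show ?case by blast
next
  case (4 A B)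
  from 4(3,4) obtain C E
    where C: "fin_ne C" "system_le S ((A + B \<union> A) + C) C"
      and E: "fin_ne E" "system_le S ((A + B \<union> B) + E) E"
    by blast
  define s where "s = A + B"
  \<comment> \<open>\<open>F\<close> is a common witness for both hypotheses, since adding
    \<open>E\<close> or \<open>C\<close> preserves the inequalities.\<close>
  define F where "F = C + E"
  \<comment> \<open>The witness is \<open>D + F\<close>, checked on the four parts of
    \<open>D\<close>: \<open>s + F\<close> lies in \<open>?L\<close>; \<open>A + F\<close> comes
    from \<open>leB\<close> shifted by \<open>A\<close>, \<open>B + F\<close> from
    \<open>leA\<close> shifted by \<open>B\<close>, and \<open>F\<close> from \<open>leA\<close> and
    \<open>leB\<close> combined. Each time the left side is \<open>F\<close> plus a subset of
    \<open>s + D\<close>.\<close>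
  define D where "D = s \<union> A \<union> B \<union> {0}"
  have fs: "fin_ne s" and fF: "fin_ne F" and fD: "fin_ne D"
    using 4(1,2) C(1) E(1) fin_ne_plus by (auto simp: s_def F_def D_def)
  have fsA: "fin_ne (s \<union> A)" and fsB: "fin_ne (s \<union> B)"
    using 4(1,2) fs by auto
  have leA: "system_le S ((s \<union> A) + F) F"
    using system_le_plus_right[OF fin_ne_plus[OF fsA C(1)] E(1)] C(2)
    by (simp add: s_def F_def add.assoc)
  have leB: "system_le S ((s \<union> B) + F) F"
    using system_le_plus_left[OF fin_ne_plus[OF fsB E(1)] C(1)] E(2)
    by (simp add: s_def F_def add.left_commute)
  let ?L = "s + (D + F)"
  have L: "system_le S ?L Y" if "system_le S (X + F) Y" "fin_ne X" "X \<subseteq> s + D" for X Y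
  proof (rule system_le_antimono[OF _ _ _ that(1)])
    show "X + F \<subseteq> ?L"
      using that(3) by (simp add: set_plus_mono2 flip: add.assoc)
  qed (use fin_ne_plus[OF that(2) fF] fin_ne_plus[OF fs fin_ne_plus[OF fD fF]] in blast)+
  have sD: "s + D = (s + s) \<union> (s + A) \<union> (s + B) \<union> s"
    by (simp add: D_def set_plus_Un flip: set_zero)
  have "system_le S ?L (s + F)"
    using fs fF fin_ne_plus by (intro L[of s] system_le_superset) (auto simp: sD)
  moreover have "system_le S ?L (A + F)"
  proof (rule L[of "A + (s \<union> B)"])
    show "system_le S (A + (s \<union> B) + F) (A + F)"
      using system_le_plus_left[OF fin_ne_plus[OF fsB fF] 4(1) leB] by (simp add: add.assoc)
    show "A + (s \<union> B) \<subseteq> s + D"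
      by (auto simp: sD set_plus_Un add.commute[of A s] simp flip: s_def)
  qed (rule fin_ne_plus[OF 4(1) fsB])
  moreover have "system_le S ?L (B + F)"
  proof (rule L[of "B + (s \<union> A)"])
    show "system_le S (B + (s \<union> A) + F) (B + F)"
      using system_le_plus_left[OF fin_ne_plus[OF fsA fF] 4(2) leA] by (simp add: add.assoc)
    show "B + (s \<union> A) \<subseteq> s + D"
      by (auto simp: sD set_plus_Un add.commute[of B s] add.commute[of B A]
          simp flip: s_def)
  qed (rule fin_ne_plus[OF 4(2) fsA])
  moreover have "system_le S ?L F"
  proof (rule L[of "(s \<union> A) + (s \<union> B)"])
    have "system_le S ((s \<union> A) + ((s \<union> B) + F)) ((s \<union> A) + F)"
      using system_le_plus_left[OF fin_ne_plus[OF fsB fF] fsA leB] .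
    then show "system_le S ((s \<union> A) + (s \<union> B) + F) F"
      using system_le_trans[OF _ fin_ne_plus[OF fsA fF] _ leA]
        fin_ne_plus[OF fsA fin_ne_plus[OF fsB fF]]
      by (simp add: add.assoc)
    show "(s \<union> A) + (s \<union> B) \<subseteq> s + D"
      by (auto simp: sD set_plus_Un Un_set_plus add.commute[of A s]
          simp flip: s_def)
  qed (rule fin_ne_plus[OF fsA fsB])
  ultimately have "system_le S ?L (D + F)"
    by (simp add: D_def Un_set_plus system_le_Un flip: set_zero)
  then show ?case
    using fin_ne_plus[OF fD fF] by (auto simp: s_def)
next
  case (5 x)
  \<comment> \<open>The sum contains \<open>{0, x}\<close>, as \<open>0 = - x + x\<close> and
    \<open>x = x + 0\<close>.\<close>
  have "system_le S ({x, - x} + {0, x}) {0, x}"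
    by (rule system_le_superset) (auto simp: set_plus_def intro: finite_set_plus)
  then show ?case by (intro exI[of _ "{0, x}"]) simp
qed

end

section \<open>The entailment relation of a regular system and its cut rule\<close>

definition entails :: "('a::ab_group_add set \<Rightarrow> bool) \<Rightarrow> 'a set \<Rightarrow> 'a set \<Rightarrow> bool"
  where "entails R A B \<longleftrightarrow> R (\<Union>b\<in>B. A \<ominus> b)"

context regular_equivariant_system_of_ideals
begin

text \<open>This is \<open>P2\<close> for the differences \<open>A - u\<close> and
  \<open>u - B\<close>, whose sum is the set of differences \<open>A - B\<close>.\<close>

lemma entails_cut:
  assumes "fin_ne A" "fin_ne B" "entails S A (insert u B)" "entails S (insert u A) B"
  shows "entails S A B"
proof -
  let ?X = "A \<ominus> u" and ?Y = "(\<lambda>b. u - b) ` B"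
  have sum: "?X + ?Y = (\<Union>b\<in>B. A \<ominus> b)"
  proof
    show "?X + ?Y \<subseteq> (\<Union>b\<in>B. A \<ominus> b)"
      by (auto simp: set_plus_def translate_down_def)
    show "(\<Union>b\<in>B. A \<ominus> b) \<subseteq> ?X + ?Y"
    proof
      fix z assume "z \<in> (\<Union>b\<in>B. A \<ominus> b)"
      then obtain a b where "a \<in> A" "b \<in> B" "z = (a - u) + (u - b)"
        by (auto simp: translate_down_def)
      then show "z \<in> ?X + ?Y"
        unfolding translate_down_def by blast
    qed
  qed
  have "?X + ?Y \<union> ?X = (\<Union>b\<in>insert u B. A \<ominus> b)"
    unfolding sum by auto
  moreover have "?X + ?Y \<union> ?Y = (\<Union>b\<in>B. insert u A \<ominus> b)"
    unfolding sum by (auto simp: translate_down_def)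
  ultimately have "S (?X + ?Y)"
    using P2[of ?X ?Y] assms fin_ne_translate_down[of A u] by (simp add: entails_def)
  then show ?thesis
    by (simp add: entails_def sum)
qed

lemma entails_weaken:
  assumes "entails S A B" "fin_ne A" "fin_ne B" "finite A'" "finite B'" "A \<subseteq> A'" "B \<subseteq> B'"
  shows "entails S A' B'"
  unfolding entails_def
proof (rule P1)
  show "S (\<Union>b\<in>B. A \<ominus> b)"
    using assms(1) by (simp add: entails_def)
  show "(\<Union>b\<in>B. A \<ominus> b) \<subseteq> (\<Union>b\<in>B'. A' \<ominus> b)"
    using assms(6,7) unfolding translate_down_def by blast
  show "fin_ne (\<Union>b\<in>B. A \<ominus> b)" "fin_ne (\<Union>b\<in>B'. A' \<ominus> b)"
    using assms(2-7) by (auto simp: translate_down_def)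
qed

text \<open>The conjunction of \<open>U\<close> serves as cut formula; its elements are cut in
  turn.\<close>

lemma entails_cut_set:
  assumes "finite U" "fin_ne A" "fin_ne B"
    and "\<And>u. u \<in> U \<Longrightarrow> entails S A (insert u B)" "entails S (A \<union> U) B"
  shows "entails S A B"
  using assms
proof (induction U arbitrary: A rule: finite_induct)
  case empty
  then show ?case by simp
next
  case (insert u U)
  have "entails S (insert u A) B"
  proof (rule insert.IH)
    show "entails S (insert u A) (insert v B)" if "v \<in> U" for v
      using insert.prems that by - (rule entails_weaken[of A "insert v B"], auto)
  qed (use insert.prems in auto)
  then show ?case
    using entails_cut[of A B u] insert.prems by auto
qed

text \<open>Induction on \<open>card B\<close> replaces the search for a cycle: a fixed point puts
  \<open>0\<close> into the set; otherwise one point is deleted and the map rerouted around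
  it.\<close>

lemma differences_of_self_map:
  assumes "fin_ne B" "f ` B \<subseteq> B"
  shows "S ((\<lambda>b. b - f b) ` B)"
  using assms
proof (induction "card B" arbitrary: B f rule: less_induct)
  case less
  show ?case
  proof (cases "\<exists>b\<in>B. f b = b")
    case True
    then obtain b where "b \<in> B" "b - f b = 0" by auto
    then have "0 \<in> (\<lambda>b. b - f b) ` B" by (metis imageI)
    then show ?thesis using less.prems by (intro contains_0) auto
  next
    case False
    obtain b where b: "b \<in> B" using less.prems by auto
    let ?B = "B - {b}"
    \<comment> \<open>\<open>g\<close> skips \<open>b\<close>: points sent to \<open>b\<close> go on
      to \<open>f b\<close>, which is not \<open>b\<close>. The differences of \<open>g\<close>
      satisfy \<open>S\<close> by induction and are then cut away.\<close>
    define g where "g c = (if f c = b then f b else f c)" for c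
    let ?X = "(\<lambda>b. b - f b) ` B" and ?U = "(\<lambda>c. c - g c) ` ?B"
    have fb: "f b \<in> ?B" using False b less.prems by auto
    have "card ?B < card B"
      using b less.prems by (simp add: card_gt_0_iff)
    moreover have "g ` ?B \<subseteq> ?B"
      using fb less.prems(2) by (auto simp: g_def)
    ultimately have U: "S ?U"
      using less.hyps[of ?B g] less.prems fb by auto
    have X: "fin_ne ?X" using less.prems by auto
    have "entails S ?X {0}"
    proof (rule entails_cut_set)
      have "S (?X \<union> ?U)"
        using U X less.prems fb by - (rule P1[of "?X \<union> ?U" ?U], auto)
      then show "entails S (?X \<union> ?U) {0}"
        by (simp add: entails_def)
      fix u assume "u \<in> ?U"
      then obtain c where c: "c \<in> ?B" "u = c - g c" by auto
      have fin: "fin_ne (\<Union>v\<in>{u, 0}. ?X \<ominus> v)"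
        using X by (auto simp: translate_down_def)
      \<comment> \<open>For \<open>f c = b\<close> the element \<open>u\<close> is the sum of \<open>v = c - f c\<close> and \<open>w = b - f b\<close>,
        so that \<open>v - u = - w\<close>.\<close>
      show "entails S ?X {u, 0}"
      proof (cases "f c = b")
        case True
        let ?w = "b - f b"
        have "?w \<in> ?X" using b by auto
        moreover have "- ?w = (c - f c) - u"
          using True c(2) by (simp add: g_def)
        then have "- ?w \<in> ?X \<ominus> u"
          using c(1) unfolding translate_down_def by blast
        ultimately have "{?w, - ?w} \<subseteq> (\<Union>v\<in>{u, 0}. ?X \<ominus> v)"
          by auto
        then show ?thesis
          unfolding entails_def using fin P5[of ?w] by - (rule P1[of _ "{?w, - ?w}"], blast+)
      next
        case False
        then have "u \<in> ?X" using c by (auto simp: g_def)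
        then have "0 \<in> (\<Union>v\<in>{u, 0}. ?X \<ominus> v)"
          unfolding translate_down_def by force
        then show ?thesis
          unfolding entails_def using fin by (intro contains_0) auto
      qed
    qed (use less.prems X in auto)
    then show ?thesis by (simp add: entails_def)
  qed
qed

section \<open>Cancellation in a regular system\<close>

lemma cancel_plus:
  assumes A: "fin_ne A" and B: "fin_ne B" and le: "system_le S (A + B) B"
  shows "S A"
proof -
  \<comment> \<open>The conjunctions of the sets \<open>(A + B) \<ominus> c\<close> are removed one at a time from the disjunction
    on the right-hand side; \<open>g\<close> chooses one conjunct for each.\<close>
  have "entails S A (insert 0 (g ` (B - C)))"
    if "C \<subseteq> B" "\<And>c. c \<in> B \<Longrightarrow> g c \<in> (A + B) \<ominus> c" for C g
    using finite_subset[OF that(1) conjunct1[OF B]] that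
  proof (induction C arbitrary: g rule: finite_induct)
    case empty
    have "\<exists>a\<in>A. \<exists>b\<in>B. g c = a + b - c" if "c \<in> B" for c
      using empty.prems(2)[OF that] by (auto simp: translate_down_def set_plus_def)
    then obtain h f where hf: "h c \<in> A" "f c \<in> B" "g c = h c + f c - c" if "c \<in> B" for c
      by metis
    \<comment> \<open>The summands from \<open>B\<close> in the chosen conjuncts form a self-map
      \<open>f\<close> of \<open>B\<close>, and \<open>c - f c = h c - g c\<close> is a difference
      between \<open>A\<close> and the right-hand side.\<close>
    let ?D = "(\<lambda>c. c - f c) ` B"
    have "S ?D"
      using differences_of_self_map B hf(2) by blast
    moreover have "?D \<subseteq> (\<Union>b\<in>insert 0 (g ` (B - {})). A \<ominus> b)"
    proof
      fix d assume "d \<in> ?D"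
      then obtain c where c: "c \<in> B" "d = c - f c" by blast
      then have "d = h c - g c" using hf(3) by simp
      then have "d \<in> A \<ominus> g c" using hf(1)[OF c(1)] by (simp add: translate_down_def)
      then show "d \<in> (\<Union>b\<in>insert 0 (g ` (B - {})). A \<ominus> b)" using c(1) by auto
    qed
    moreover have "fin_ne (\<Union>b\<in>insert 0 (g ` (B - {})). A \<ominus> b)"
      using A B by (auto simp: translate_down_def)
    ultimately show ?case
      unfolding entails_def using P1[of _ ?D] B by auto
  next
    case (insert c C)
    let ?T = "(A + B) \<ominus> c" and ?V = "insert 0 (g ` (B - insert c C))"
    have T: "fin_ne ?T"
      by (intro fin_ne_translate_down fin_ne_plus A B)
    show ?case
    proof (rule entails_cut_set)
      show "finite ?T" "fin_ne A" "fin_ne ?V" using A B T by auto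
      \<comment> \<open>By \<open>le\<close>, the conjunction of \<open>?T\<close> entails
        \<open>0\<close>, which always stays on the right-hand side.\<close>
      have "S ?T" using le insert.prems(1) by (simp add: system_le_def)
      then have "entails S ?T {0}" by (simp add: entails_def)
      then show "entails S (A \<union> ?T) ?V"
        using A B T by - (rule entails_weaken[of ?T "{0}"], auto)
      fix u assume u: "u \<in> ?T"
      \<comment> \<open>Changing the choice at \<open>c\<close> reaches every conjunct
        \<open>u\<close> of \<open>?T\<close>.\<close>
      let ?g = "g(c := u)"
      have "entails S A (insert 0 (?g ` (B - C)))"
        using insert.prems u by (intro insert.IH) auto
      moreover have "insert 0 (?g ` (B - C)) = insert u ?V"
        using insert.hyps(2) insert.prems(1) by auto
      ultimately show "entails S A (insert u ?V)" by simp
    qed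
  qed
  moreover have "\<exists>g. \<forall>c\<in>B. g c \<in> (A + B) \<ominus> c"
    using fin_ne_translate_down[OF fin_ne_plus[OF A B]] by (intro bchoice) blast
  ultimately have "entails S A (insert 0 ({} :: 'a set))"
    by (metis Diff_cancel image_empty order_refl)
  then show ?thesis by (simp add: entails_def)
qed

end

theorem theorem6p1:
  fixes S R :: "'a::preordered_ab_group_add set \<Rightarrow> bool"
    and A :: "'a set"
  assumes "equivariant_system_of_ideals S"
    and "is_regularisation S R"
    and "finite A" and "A \<noteq> {}"
  shows "R A \<longleftrightarrow> (\<exists>B. finite B \<and> B \<noteq> {} \<and> system_le S (A + B) B)"
proof
  let ?Q = "\<lambda>A. \<exists>B. fin_ne B \<and> system_le S (A + B) B"
  interpret S: equivariant_system_of_ideals S by fact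
  \<comment> \<open>With \<open>B = {0}\<close> the right-hand side contains \<open>S\<close>, so
    leastness of \<open>R\<close> applies.\<close>
  have "system_contains ?Q S"
    unfolding system_contains_def
  proof (intro allI impI)
    fix X :: "'a set" assume "S X"
    then have "system_le S (X + {0}) {0}"
      by (simp add: system_le_def set_plus_def)
    then show "?Q X" by blast
  qed
  then have "system_contains ?Q R"
    using assms(2) S.regular_exists_plus_le by (simp add: is_regularisation_def)
  then show "\<exists>B. finite B \<and> B \<noteq> {} \<and> system_le S (A + B) B" if "R A"
    using that assms(3,4) by (auto simp: system_contains_def)
next
  assume "\<exists>B. finite B \<and> B \<noteq> {} \<and> system_le S (A + B) B"
  then obtain B where B: "fin_ne B" "system_le S (A + B) B" by blast
  interpret R: regular_equivariant_system_of_ideals R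
    using assms(2) by (simp add: is_regularisation_def)
  \<comment> \<open>Containment turns the inequality for \<open>S\<close> into one for
    \<open>R\<close>, where \<open>B\<close> can be cancelled.\<close>
  have "system_contains R S"
    using assms(2) by (simp add: is_regularisation_def)
  then have "system_le R (A + B) B"
    using B assms(3,4) fin_ne_plus[of A B] fin_ne_translate_down[of "A + B"]
    by (simp add: system_le_def system_contains_def)
  then show "R A"
    using R.cancel_plus B(1) assms(3,4) by blast
qed

end
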